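(* Let $X$ be an infinite-dimensional complex Banach space and $T\in L(X)$, and suppose $T$ admits a GKRD $(M,N)$. Then there exists $\epsilon>0$ such that $T-\lambda$ is essentially Kato for every $\lambda$ with $0<|\lambda|<\epsilon$.
   Context: $S$ is Kato if $R(S)$ is closed and $N(S)\subset R(S^n)$ for all $n\in\mathbb N$; $S$ is Riesz if $S-\lambda$ is Fredholm for all $\lambda\neq0$; $T$ admits a GKRD $(M,N)$ if $M,N$ are closed $T$-invariant subspaces with $X=M\oplus N$, $T_M$ Kato and $T_N$ Riesz. An operator $S$ is essentially Kato if there are closed $S$-invariant subspaces $M,N$ with $X=M\oplus N$, $N$ finite-dimensional, $S_M$ Kato and $S_N$ nilpotent (equivalently quasinilpotent). *)

theory Defs
  imports "HOL-Analysis.Analysis"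
begin

text \<open>A complex Banach space is modelled as a real Banach space 'a together with
  a complex structure J (multiplication by the imaginary unit).\<close>

definition cscale :: "('a::real_vector \<Rightarrow> 'a) \<Rightarrow> complex \<Rightarrow> 'a \<Rightarrow> 'a" where
  "cscale J c x = Re c *\<^sub>R x + Im c *\<^sub>R J x"

definition complex_structure :: "('a::real_normed_vector \<Rightarrow> 'a) \<Rightarrow> bool" where
  "complex_structure J \<longleftrightarrow> bounded_linear J \<and> (\<forall>x. J (J x) = - x)
     \<and> (\<forall>c x. norm (cscale J c x) = cmod c * norm x)"

definition csubspace :: "('a::real_vector \<Rightarrow> 'a) \<Rightarrow> 'a set \<Rightarrow> bool" where
  "csubspace J M \<longleftrightarrow> subspace M \<and> (\<forall>x\<in>M. J x \<in> M)"

definition cblinear_op :: "('a::real_normed_vector \<Rightarrow> 'a) \<Rightarrow> ('a \<Rightarrow> 'a) \<Rightarrow> bool" where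
  "cblinear_op J T \<longleftrightarrow> bounded_linear T \<and> (\<forall>x. T (J x) = J (T x))"

text \<open>Finite-dimensionality (real and complex finite dimension coincide).\<close>
definition fin_dim :: "'a::real_vector set \<Rightarrow> bool" where
  "fin_dim S \<longleftrightarrow> (\<exists>B. finite B \<and> S \<subseteq> span B)"

definition direct_sum :: "'a::real_vector set \<Rightarrow> 'a set \<Rightarrow> bool" where
  "direct_sum M N \<longleftrightarrow> M \<inter> N = {0} \<and> (\<forall>x. \<exists>m\<in>M. \<exists>n\<in>N. x = m + n)"

definition kato_on :: "'a::real_normed_vector set \<Rightarrow> ('a \<Rightarrow> 'a) \<Rightarrow> bool" where
  "kato_on M S \<longleftrightarrow> closed (S ` M) \<and> (\<forall>n::nat. {x\<in>M. S x = 0} \<subseteq> (S ^^ n) ` M)"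

definition fredholm_on :: "'a::real_normed_vector set \<Rightarrow> ('a \<Rightarrow> 'a) \<Rightarrow> bool" where
  "fredholm_on N A \<longleftrightarrow> fin_dim {x\<in>N. A x = 0} \<and> closed (A ` N)
     \<and> (\<exists>F. subspace F \<and> fin_dim F \<and> F \<subseteq> N \<and> N \<subseteq> {a + f | a f. a \<in> A ` N \<and> f \<in> F})"

definition riesz_on :: "('a::real_normed_vector \<Rightarrow> 'a) \<Rightarrow> 'a set \<Rightarrow> ('a \<Rightarrow> 'a) \<Rightarrow> bool" where
  "riesz_on J N S \<longleftrightarrow> (\<forall>l::complex. l \<noteq> 0 \<longrightarrow> fredholm_on N (\<lambda>x. S x - cscale J l x))"

definition GKRD :: "('a::real_normed_vector \<Rightarrow> 'a) \<Rightarrow> ('a \<Rightarrow> 'a) \<Rightarrow> 'a set \<Rightarrow> 'a set \<Rightarrow> bool" where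
  "GKRD J T M N \<longleftrightarrow> csubspace J M \<and> csubspace J N \<and> closed M \<and> closed N
     \<and> T ` M \<subseteq> M \<and> T ` N \<subseteq> N \<and> direct_sum M N \<and> kato_on M T \<and> riesz_on J N T"

definition essentially_kato :: "('a::real_normed_vector \<Rightarrow> 'a) \<Rightarrow> ('a \<Rightarrow> 'a) \<Rightarrow> bool" where
  "essentially_kato J S \<longleftrightarrow> (\<exists>M N. csubspace J M \<and> csubspace J N \<and> closed M \<and> closed N
     \<and> S ` M \<subseteq> M \<and> S ` N \<subseteq> N \<and> direct_sum M N \<and> fin_dim N \<and> kato_on M S
     \<and> (\<exists>n::nat. \<forall>x\<in>N. (S ^^ n) x = 0))"

end

theory Submission
  imports Defs
begin

text \<open>On \<open>M\<close> the restriction of \<open>T\<close> is Kato, and this survives small commuting perturbations: \<open>T\<close> maps the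
  closed subspace \<open>W = (\<Inter>n. T\<^sup>n M)\<close> onto itself and induces an operator that is bounded below on
  \<open>M/W\<close>; both properties are stable, and together they force \<open>T - \<lambda>\<close> to have closed range and its
  kernel to lie in \<open>W\<close>, which \<open>T - \<lambda>\<close> again maps onto itself.

  On \<open>N\<close> the operator \<open>A = T - \<lambda>\<close> is Fredholm, and every Fredholm operator is the sum of a Kato and a
  finite-dimensional nilpotent operator. If \<open>A\<close> is not Kato, take the least \<open>m\<close> for which the kernel is
  not contained in \<open>A\<^sup>m\<^sup>+\<^sup>1 N\<close>, a kernel vector \<open>A\<^sup>m z\<close> outside that range, and a closed complex
  hyperplane \<open>H\<close> containing the range but not \<open>A\<^sup>m z\<close>. The span of the chain \<open>z, A z, ..., A\<^sup>m z\<close> is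
  complemented by the invariant subspace of all \<open>x\<close> with \<open>A\<^sup>i x \<in> H\<close> for \<open>i \<le> m\<close>, on which the kernel of
  \<open>A\<close> has smaller dimension.\<close>

section \<open>Operators with closed range\<close>

text \<open>Newton-type iteration: \<open>step\<close> is applied to the successive residuals, which
  stay in \<open>Y\<close> and shrink like \<open>q ^ k\<close>, so the corrections form an
  absolutely convergent series whose sum lies in the closed subspace \<open>M\<close>.
  \<open>Y\<close> is an arbitrary set, so that it can be the image of \<open>M\<close>, the closure
  of that image, or an invariant subspace.\<close>

lemma successive_approximation:
  fixes A :: "'a::banach \<Rightarrow> 'b::real_normed_vector"
  assumes A: "bounded_linear A" and M: "closed M" "subspace M"
    and q: "0 \<le> q" "q < 1"
    and step: "\<And>y. y \<in> Y \<Longrightarrow>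
      \<exists>x\<in>M. norm x \<le> c * norm y \<and> y - A x \<in> Y \<and> norm (y - A x) \<le> q * norm y"
    and y: "y \<in> Y"
  shows "\<exists>x\<in>M. A x = y \<and> norm x \<le> c / (1 - q) * norm y"
proof (cases "y = 0")
  case True
  then show ?thesis
    using M(2) by (auto intro!: bexI[of _ 0] simp: linear_0[OF bounded_linear.linear[OF A]] subspace_0)
next
  case False
  obtain g where g: "\<And>y. y \<in> Y \<Longrightarrow>
      g y \<in> M \<and> norm (g y) \<le> c * norm y \<and> y - A (g y) \<in> Y \<and> norm (y - A (g y)) \<le> q * norm y"
    using step by metis
  have "0 \<le> c * norm y"
    using g[OF y] norm_ge_zero order_trans by blast
  then have c: "0 \<le> c"
    using False by (simp add: zero_le_mult_iff)
  define r where "r k = ((\<lambda>y. y - A (g y)) ^^ k) y" for k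
  have r_Suc: "r (Suc k) = r k - A (g (r k))" and r0: "r 0 = y" for k
    by (auto simp: r_def)
  have rY: "r k \<in> Y" for k
    by (induction k) (auto simp: r0 r_Suc y g)
  have rn: "norm (r k) \<le> q ^ k * norm y" for k
  proof (induction k)
    case (Suc k)
    have "norm (r (Suc k)) \<le> q * norm (r k)"
      using g[OF rY] by (simp add: r_Suc)
    also have "\<dots> \<le> q * (q ^ k * norm y)"
      using Suc q by (intro mult_left_mono) auto
    finally show ?case by simp
  qed (simp add: r0)
  have gn: "norm (g (r k)) \<le> c * norm y * q ^ k" for k
  proof -
    have "norm (g (r k)) \<le> c * norm (r k)" using g[OF rY] by blast
    also have "\<dots> \<le> c * (q ^ k * norm y)" using rn c by (intro mult_left_mono)
    finally show ?thesis by (simp add: mult_ac)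
  qed
  have sg: "summable (\<lambda>k. c * norm y * q ^ k)"
    using q by (intro summable_mult summable_geometric) auto
  have sm: "summable (\<lambda>k. norm (g (r k)))"
    by (rule summable_comparison_test'[OF sg, of 0]) (simp add: gn)
  then have s: "summable (\<lambda>k. g (r k))" by (rule summable_norm_cancel)
  define x where "x = (\<Sum>k. g (r k))"
  have lim: "(\<lambda>n. \<Sum>k<n. g (r k)) \<longlonglongrightarrow> x"
    using s unfolding x_def by (rule summable_LIMSEQ)
  have xM: "x \<in> M"
  proof (rule closed_sequentially[OF M(1) _ lim])
    show "(\<Sum>k<n. g (r k)) \<in> M" for n
      using M(2) g[OF rY] by (intro subspace_sum) auto
  qed
  have "A (\<Sum>k<n. g (r k)) = y - r n" for n
    by (induction n)
      (simp_all add: r0 r_Suc bounded_linear.linear[OF A] linear_0 linear_add algebra_simps)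
  moreover have "(\<lambda>n. A (\<Sum>k<n. g (r k))) \<longlonglongrightarrow> A x"
    by (rule bounded_linear.tendsto[OF A lim])
  ultimately have l1: "(\<lambda>n. y - r n) \<longlonglongrightarrow> A x" by simp
  have "(\<lambda>n. q ^ n * norm y) \<longlonglongrightarrow> 0"
    using q by (intro tendsto_mult_left_zero LIMSEQ_power_zero) auto
  then have "r \<longlonglongrightarrow> 0"
    by (rule Lim_null_comparison[rotated]) (simp add: rn)
  then have "(\<lambda>n. y - r n) \<longlonglongrightarrow> y - 0" by (intro tendsto_intros)
  with l1 have "A x = y" using LIMSEQ_unique by fastforce
  moreover have "norm x \<le> c / (1 - q) * norm y"
  proof -
    have "norm x \<le> (\<Sum>k. norm (g (r k)))" unfolding x_def by (rule summable_norm[OF sm])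
    also have "\<dots> \<le> (\<Sum>k. c * norm y * q ^ k)" by (rule suminf_le[OF gn sm sg])
    also have "\<dots> = c / (1 - q) * norm y"
      using q by (subst suminf_mult) (auto simp: suminf_geometric summable_geometric)
    finally show ?thesis .
  qed
  ultimately show ?thesis using xM by blast
qed

lemma subspace_closure:
  fixes S :: "'a::real_normed_vector set"
  assumes "subspace S"
  shows "subspace (closure S)"
  unfolding subspace_def
proof (intro conjI ballI allI)
  show "0 \<in> closure S"
    using assms closure_subset subspace_0 by blast
  fix x assume "x \<in> closure S"
  then obtain u where u: "\<And>n. u n \<in> S" "u \<longlonglongrightarrow> x"
    unfolding closure_sequential by blast
  show "c *\<^sub>R x \<in> closure S" for c
    unfolding closure_sequential using u assms
    by (intro exI[of _ "\<lambda>n. c *\<^sub>R u n"]) (auto intro!: tendsto_intros simp: subspace_scale)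
  fix y assume "y \<in> closure S"
  then obtain v where v: "\<And>n. v n \<in> S" "v \<longlonglongrightarrow> y"
    unfolding closure_sequential by blast
  show "x + y \<in> closure S"
    unfolding closure_sequential using u v assms
    by (intro exI[of _ "\<lambda>n. u n + v n"]) (auto intro!: tendsto_intros simp: subspace_add)
qed

text \<open>Successive approximation runs on the closure of the image: a point \<open>y\<close> of
  the closure is approximated within half its norm by some \<open>y'\<close> in the image, and
  lifting \<open>y'\<close> leaves a residual that is again in the closure. Since
  \<open>norm y'\<close> is at most \<open>2 * norm y\<close>, the constant doubles. This is the
  criterion by which closed range is proved below.\<close>

lemma closed_image_if_bounded_lifting:
  fixes A :: "'a::banach \<Rightarrow> 'b::real_normed_vector"
  assumes A: "bounded_linear A" and M: "closed M" "subspace M"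
    and lift: "\<And>y. y \<in> A ` M \<Longrightarrow> \<exists>x\<in>M. A x = y \<and> norm x \<le> c * norm y"
  shows "closed (A ` M)"
proof -
  have sub: "subspace (closure (A ` M))"
    by (intro subspace_closure linear_subspace_image bounded_linear.linear[OF A] M)
  define C where "C = max c 0"
  have C: "0 \<le> C" "c \<le> C" by (auto simp: C_def)
  have "y \<in> A ` M" if y: "y \<in> closure (A ` M)" for y
  proof -
    have "\<exists>x\<in>M. A x = y \<and> norm x \<le> 2 * C / (1 - 1/2) * norm y"
    proof (rule successive_approximation[OF A M _ _ _ y])
      fix y assume y: "y \<in> closure (A ` M)"
      show "\<exists>x\<in>M. norm x \<le> 2 * C * norm y \<and> y - A x \<in> closure (A ` M) \<and>
                 norm (y - A x) \<le> 1/2 * norm y"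
      proof (cases "y = 0")
        case True
        then show ?thesis using M(2) sub
          by (auto intro!: bexI[of _ 0] simp: linear_0[OF bounded_linear.linear[OF A]] subspace_0)
      next
        case False
        obtain y' where y': "y' \<in> A ` M" "dist y' y < norm y / 2"
          using y False unfolding closure_approachable by (metis half_gt_zero zero_less_norm_iff)
        obtain x where x: "x \<in> M" "A x = y'" "norm x \<le> c * norm y'"
          using lift[OF y'(1)] by blast
        have "norm y' \<le> norm y + norm (y' - y)"
          using norm_triangle_ineq[of y "y' - y"] by simp
        then have "norm y' \<le> 2 * norm y" using y'(2) norm_ge_zero[of y] unfolding dist_norm by linarith
        then have "c * norm y' \<le> C * (2 * norm y)"
          using C by (intro mult_mono) auto
        then have "norm x \<le> 2 * C * norm y" using x(3) by simp
        moreover have "norm (y - A x) \<le> 1/2 * norm y"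
          using y'(2) x(2) by (simp add: dist_norm norm_minus_commute)
        moreover have "y - A x \<in> closure (A ` M)"
          using sub y x(1) closure_subset[of "A ` M"] by (intro subspace_diff) auto
        ultimately show ?thesis using x(1) by blast
      qed
    qed auto
    then show ?thesis by blast
  qed
  then show ?thesis by (simp add: subsetI flip: closure_subset_eq)
qed

lemma open_mapping_lifting:
  fixes A :: "'a::banach \<Rightarrow> 'b::banach"
  assumes A: "bounded_linear A" and M: "closed M" "subspace M"
    and cl: "closed (A ` M)"
  obtains c where "c > 0" "\<And>y. y \<in> A ` M \<Longrightarrow> \<exists>x\<in>M. A x = y \<and> norm x \<le> c * norm y"
proof -
  note lin = bounded_linear.linear[OF A]
  let ?Y = "A ` M"
  have subY: "subspace ?Y" by (intro linear_subspace_image lin M)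
  define D where "D n = closure (A ` (M \<inter> cball 0 (real n)))" for n
  have DY: "D n \<subseteq> ?Y" for n
    unfolding D_def using cl by (intro closure_minimal) auto
  have UN: "(\<Union>n. D n) = ?Y"
  proof
    show "?Y \<subseteq> (\<Union>n. D n)"
    proof
      fix y assume "y \<in> ?Y"
      then obtain x where x: "x \<in> M" "y = A x" by blast
      obtain n :: nat where "norm x \<le> real n" using real_arch_simple by blast
      then have "y \<in> A ` (M \<inter> cball 0 (real n))" using x by auto
      then have "y \<in> D n" unfolding D_def using closure_subset[of "A ` (M \<inter> cball 0 (real n))"] by (rule subsetD[rotated])
      then show "y \<in> (\<Union>n. D n)" by blast
    qed
  qed (intro UN_least DY)
  have "\<exists>n. (top_of_set ?Y) interior_of (D n) \<noteq> {}"
  proof (rule ccontr)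
    assume a: "\<not> ?thesis"
    have "(top_of_set ?Y) interior_of \<Union>(range D) = {}"
    proof (rule Baire_category_alt)
      show "completely_metrizable_space (top_of_set ?Y) \<or>
        locally_compact_space (top_of_set ?Y) \<and> regular_space (top_of_set ?Y)"
        by (intro disjI1 completely_metrizable_space_closedin completely_metrizable_space_euclidean)
          (use cl in auto)
      show "closedin (top_of_set ?Y) T \<and> (top_of_set ?Y) interior_of T = {}"
        if T: "T \<in> range D" for T
      proof -
        obtain n where n: "T = D n" using T by blast
        have "closed (D n)" by (simp add: D_def)
        then show ?thesis using n a DY[of n] by (simp add: closed_subset)
      qed
    qed auto
    then have "(top_of_set ?Y) interior_of ?Y = {}" using UN by simp
    then have "?Y = {}" using interior_of_topspace[of "top_of_set ?Y"] by simp
    then show False using M(2) subspace_0 by blast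
  qed
  then obtain n y0 where "y0 \<in> (top_of_set ?Y) interior_of (D n)" by blast
  then obtain U where U: "openin (top_of_set ?Y) U" "y0 \<in> U" "U \<subseteq> D n"
    unfolding interior_of_def by auto
  then obtain d where d: "d > 0" "\<And>z. z \<in> ?Y \<Longrightarrow> dist z y0 < d \<Longrightarrow> z \<in> D n"
    unfolding openin_euclidean_subtopology_iff by (metis subsetD)
  have y0: "y0 \<in> ?Y" using U openin_subset by fastforce
  \<comment> \<open>The ball inside \<open>D n\<close> is centred at \<open>y0\<close>. Subtracting
    approximate preimages of \<open>y0 + z\<close> and \<open>y0\<close> moves it to the origin, at
    the price of the radius \<open>2 * real n\<close>.\<close>
  have small: "\<exists>x\<in>M. norm x \<le> 2 * real n \<and> norm (z - A x) < e"
    if z: "z \<in> ?Y" "norm z < d" and e: "e > 0" for z e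
  proof -
    have "y0 + z \<in> D n" "y0 \<in> D n"
      using d z y0 subY by (auto intro!: d(2) simp: subspace_add dist_norm)
    then have "\<exists>u\<in>A ` (M \<inter> cball 0 (real n)). dist u (y0 + z) < e/2"
      "\<exists>u\<in>A ` (M \<inter> cball 0 (real n)). dist u y0 < e/2"
      using half_gt_zero[OF e] unfolding D_def closure_approachable by blast+
    then obtain x1 x2 where x: "x1 \<in> M" "x2 \<in> M" "norm x1 \<le> real n" "norm x2 \<le> real n"
      "dist (A x1) (y0 + z) < e/2" "dist (A x2) y0 < e/2"
      by auto
    have "norm (x1 - x2) \<le> 2 * real n"
      using norm_triangle_ineq4[of x1 x2] x by simp
    moreover have "norm (z - A (x1 - x2)) < e"
    proof -
      have eq: "z - A (x1 - x2) = (A x2 - y0) - (A x1 - (y0 + z))"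
        by (simp add: linear_diff[OF lin])
      show ?thesis
        unfolding eq using norm_triangle_ineq4[of "A x2 - y0" "A x1 - (y0 + z)"] x(5,6)
        unfolding dist_norm by linarith
    qed
    ultimately show ?thesis using x M(2) subspace_diff by blast
  qed
  \<comment> \<open>\<open>y\<close> is rescaled to norm \<open>d / 2\<close> and approximated
    within \<open>d / 4\<close>, which is a relative error of \<open>1/2\<close>. Undoing the
    scaling multiplies the bound \<open>2 * real n\<close> by \<open>2 * norm y / d\<close>.\<close>
  define c where "c = 4 * real n / d"
  have lift: "\<exists>x\<in>M. A x = y \<and> norm x \<le> c / (1 - 1/2) * norm y" if "y \<in> ?Y" for y
  proof (rule successive_approximation[OF A M _ _ _ that])
    fix y assume y: "y \<in> ?Y"
    show "\<exists>x\<in>M. norm x \<le> c * norm y \<and> y - A x \<in> ?Y \<and> norm (y - A x) \<le> 1/2 * norm y"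
    proof (cases "y = 0")
      case True
      then show ?thesis using M(2) subY
        by (auto intro!: bexI[of _ 0] simp: linear_0[OF lin] subspace_0)
    next
      case False
      define t where "t = d / (2 * norm y)"
      have t: "t > 0" using d False by (simp add: t_def)
      have ty: "norm (t *\<^sub>R y) = d / 2" using d(1) False by (simp add: t_def)
      obtain x where x: "x \<in> M" "norm x \<le> 2 * real n" "norm (t *\<^sub>R y - A x) < d / 4"
        using small[of "t *\<^sub>R y" "d/4"] d ty y subY by (auto simp: subspace_scale)
      let ?x = "inverse t *\<^sub>R x"
      have xM: "?x \<in> M" using x M(2) by (simp add: subspace_scale)
      have "norm ?x \<le> inverse t * (2 * real n)" using x t by simp
      also have "\<dots> = c * norm y" using d by (simp add: c_def t_def)
      finally have n1: "norm ?x \<le> c * norm y" .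
      have "y - A ?x = inverse t *\<^sub>R (t *\<^sub>R y - A x)"
        using t by (simp add: linear_cmul[OF lin] scaleR_diff_right)
      then have "norm (y - A ?x) = inverse t * norm (t *\<^sub>R y - A x)" using t by simp
      also have "\<dots> \<le> inverse t * (d / 4)" using x(3) t by simp
      also have "\<dots> = 1/2 * norm y" using d by (simp add: t_def)
      finally have n2: "norm (y - A ?x) \<le> 1/2 * norm y" .
      have "y - A ?x \<in> ?Y" using y xM subY by (simp add: subspace_diff)
      with xM n1 n2 show ?thesis by blast
    qed
  qed auto
  show ?thesis
  proof (rule that[of "2 * c + 1"])
    \<comment> \<open>The summand 1 secures positivity even when \<open>n = 0\<close>, where
      \<open>c\<close> vanishes.\<close>
    show "2 * c + 1 > 0" using d by (simp add: c_def add_nonneg_pos)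
    fix y assume "y \<in> ?Y"
    then obtain x where x: "x \<in> M" "A x = y" "norm x \<le> 2 * c * norm y" using lift[of y] by auto
    have "2 * c * norm y \<le> (2 * c + 1) * norm y" by (simp add: mult_right_mono)
    then show "\<exists>x\<in>M. A x = y \<and> norm x \<le> (2 * c + 1) * norm y"
      using x by (intro bexI[of _ x]) auto
  qed
qed

lemma closed_image_subspace:
  fixes A :: "'a::banach \<Rightarrow> 'b::banach"
  assumes A: "bounded_linear A" and M: "closed M" "subspace M" and cl: "closed (A ` M)"
    and L: "closed L" "subspace L" "L \<subseteq> M" and ker: "{x\<in>M. A x = 0} \<subseteq> L"
  shows "closed (A ` L)"
proof -
  obtain c where c: "c > 0" "\<And>y. y \<in> A ` M \<Longrightarrow> \<exists>x\<in>M. A x = y \<and> norm x \<le> c * norm y"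
    using open_mapping_lifting[OF A M cl] by blast
  show ?thesis
  proof (rule closed_image_if_bounded_lifting[OF A L(1,2)])
    fix y assume "y \<in> A ` L"
    then obtain l where l: "l \<in> L" "y = A l" by blast
    then obtain x where x: "x \<in> M" "A x = y" "norm x \<le> c * norm y" using c L by blast
    have "x - l \<in> {x\<in>M. A x = 0}"
      using x l L M(2) by (auto simp: linear_diff[OF bounded_linear.linear[OF A]] subspace_diff)
    then have "x \<in> L" using ker l(1) L(2) by (metis diff_add_cancel subspace_add subsetD)
    then show "\<exists>x\<in>L. A x = y \<and> norm x \<le> c * norm y" using x by blast
  qed
qed

section \<open>Perturbation of Kato operators\<close>

lemma funpow_commute:
  assumes "\<And>x. S (P x) = P (S x)"
  shows "(S ^^ n) (P x) = P ((S ^^ n) x)"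
  by (induction n) (simp_all add: assms)

lemma bounded_linear_funpow:
  assumes "bounded_linear (S :: 'a::real_normed_vector \<Rightarrow> 'a)"
  shows "bounded_linear (S ^^ n)"
proof (induction n)
  case 0
  then show ?case by (simp add: id_def bounded_linear_ident)
next
  case (Suc n)
  then show ?case using bounded_linear_compose[OF assms Suc] by (simp add: comp_def)
qed

lemma funpow_image_subset: "S ` M \<subseteq> M \<Longrightarrow> (S ^^ n) ` M \<subseteq> M"
  by (induction n) (auto simp: image_subset_iff)

lemma closed_funpow_image:
  fixes S :: "'a::banach \<Rightarrow> 'a"
  assumes S: "bounded_linear S" and M: "closed M" "subspace M" "S ` M \<subseteq> M"
    and K: "kato_on M S"
  shows "closed ((S ^^ n) ` M)"
proof (induction n)
  case 0
  then show ?case using M by simp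
next
  case (Suc n)
  have "closed (S ` ((S ^^ n) ` M))"
  proof (rule closed_image_subspace[OF S M(1,2) _ Suc])
    show "subspace ((S ^^ n) ` M)"
      by (intro linear_subspace_image bounded_linear.linear bounded_linear_funpow S M)
  qed (use K funpow_image_subset[OF M(3)] in \<open>auto simp: kato_on_def\<close>)
  then show ?case by (simp add: image_comp)
qed

text \<open>\<open>P\<close> stands for multiplication by a small scalar; what matters is that it
  commutes with \<open>S\<close>, preserves \<open>M\<close> and is small. The threshold is the
  reciprocal of a lifting constant \<open>c\<close> of \<open>S\<close> on \<open>M\<close>, which
  makes \<open>q = r * c\<close> a contraction ratio.\<close>

lemma kato_on_perturbation:
  fixes S :: "'a::banach \<Rightarrow> 'a"
  assumes S: "bounded_linear S" and M: "closed M" "subspace M" "S ` M \<subseteq> M"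
    and K: "kato_on M S"
  obtains e where "e > 0"
    "\<And>P r. bounded_linear P \<Longrightarrow> (\<And>x. S (P x) = P (S x)) \<Longrightarrow> P ` M \<subseteq> M \<Longrightarrow>
      0 < r \<Longrightarrow> r < e \<Longrightarrow> (\<And>x. norm (P x) \<le> r * norm x) \<Longrightarrow> kato_on M (\<lambda>x. S x - P x)"
proof -
  have clS: "closed (S ` M)" and ker: "\<And>n. {x\<in>M. S x = 0} \<subseteq> (S ^^ n) ` M"
    using K by (auto simp: kato_on_def)
  obtain c where c: "c > 0" "\<And>y. y \<in> S ` M \<Longrightarrow> \<exists>x\<in>M. S x = y \<and> norm x \<le> c * norm y"
    using open_mapping_lifting[OF S M(1,2) clS] by blast
  define W where "W = (\<Inter>n. (S ^^ n) ` M)"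
  have clW: "closed W"
    unfolding W_def by (intro closed_INT ballI closed_funpow_image[OF S M K])
  have subW: "subspace W"
    unfolding W_def
    by (intro subspace_Inter) (auto intro!: linear_subspace_image bounded_linear.linear
        bounded_linear_funpow S M)
  have WM: "W \<subseteq> M"
  proof -
    have "W \<subseteq> (S ^^ 0) ` M" unfolding W_def by blast
    then show ?thesis by simp
  qed
  have inv: "P x \<in> W" if x: "x \<in> W" and P: "\<And>x. S (P x) = P (S x)" "P ` M \<subseteq> M" for P x
    unfolding W_def
  proof
    fix n
    obtain m where m: "m \<in> M" "x = (S ^^ n) m" using x unfolding W_def by blast
    then have "P x = (S ^^ n) (P m)" using funpow_commute[of S P n m, OF P(1)] by simp
    then show "P x \<in> (S ^^ n) ` M" using m P(2) by blast
  qed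
  have pre: "x \<in> W" if x: "x \<in> M" "S x \<in> W" for x
    unfolding W_def
  proof
    fix n
    have "S x \<in> (S ^^ Suc n) ` M" using x(2) unfolding W_def by blast
    then obtain m where m: "m \<in> M" "S x = S ((S ^^ n) m)" by auto
    let ?z = "(S ^^ n) m"
    have z: "?z \<in> M" using funpow_image_subset[OF M(3), of n] m by blast
    have "x - ?z \<in> {x\<in>M. S x = 0}"
      using x z m M(2) by (simp add: linear_diff[OF bounded_linear.linear[OF S]] subspace_diff)
    then have "x - ?z \<in> (S ^^ n) ` M" using ker by blast
    moreover have "subspace ((S ^^ n) ` M)"
      by (intro linear_subspace_image bounded_linear.linear bounded_linear_funpow S M)
    ultimately have "(x - ?z) + ?z \<in> (S ^^ n) ` M" using m by (intro subspace_add) auto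
    then show "x \<in> (S ^^ n) ` M" by simp
  qed
  have WS: "W \<subseteq> S ` M"
  proof -
    have "W \<subseteq> (S ^^ 1) ` M" unfolding W_def by blast
    then show ?thesis by simp
  qed
  show ?thesis
  proof (rule that[of "1 / c"])
    show "1 / c > 0" using c by simp
    fix P :: "'a \<Rightarrow> 'a" and r :: real
    assume P: "bounded_linear P" "\<And>x. S (P x) = P (S x)" "P ` M \<subseteq> M"
      and r: "0 < r" "r < 1 / c" and Pr: "\<And>x. norm (P x) \<le> r * norm x"
    define q where "q = r * c"
    have q: "0 < q" "q < 1" using r c by (auto simp: q_def field_simps)
    define R where "R = (\<lambda>x. S x - P x)"
    have blR: "bounded_linear R" unfolding R_def by (intro bounded_linear_sub S P)
    note linR = bounded_linear.linear[OF blR]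
    have RW: "R x \<in> W" if "x \<in> W" for x
      unfolding R_def using subW inv[OF that refl M(3)] inv[OF that P(2,3)]
      by (rule subspace_diff)
    \<comment> \<open>A bounded \<open>S\<close>-preimage \<open>x\<close> of \<open>y\<close>
      belongs to \<open>W\<close> by \<open>pre\<close>. Using it as approximate
      \<open>R\<close>-preimage leaves the residual \<open>P x\<close>, which stays in
      \<open>W\<close> and has norm at most \<open>q * norm y\<close>.\<close>
    have onto: "\<exists>x\<in>W. R x = w \<and> norm x \<le> c / (1 - q) * norm w" if w: "w \<in> W" for w
    proof (rule successive_approximation[OF blR clW subW _ q(2) _ w])
      fix y assume y: "y \<in> W"
      then obtain x where x: "x \<in> M" "S x = y" "norm x \<le> c * norm y" using c WS by blast
      have xW: "x \<in> W" using pre x y by blast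
      have "norm (P x) \<le> r * norm x" by (rule Pr)
      also have "\<dots> \<le> r * (c * norm y)" using x r by (intro mult_left_mono) auto
      finally have "norm (P x) \<le> q * norm y" by (simp add: q_def)
      moreover have "y - R x = P x" using x by (simp add: R_def)
      moreover have "P x \<in> W" by (rule inv[OF xW P(2,3)])
      ultimately show "\<exists>x\<in>W. norm x \<le> c * norm y \<and> y - R x \<in> W \<and> norm (y - R x) \<le> q * norm y"
        using x xW by (intro bexI[of _ x]) auto
    qed (use q in auto)
    have Wpow: "W \<subseteq> (R ^^ n) ` M" for n
    proof -
      have "W \<subseteq> (R ^^ n) ` W"
      proof (induction n)
        case (Suc n)
        have "W \<subseteq> R ` W" using onto by blast
        also have "\<dots> \<subseteq> R ` ((R ^^ n) ` W)" using Suc by (rule image_mono)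
        finally show ?case by (simp add: image_comp)
      qed simp
      then show ?thesis using WM by blast
    qed
    have W0: "W \<noteq> {}" using subW subspace_0 by blast
    \<comment> \<open>\<open>R\<close> is bounded below modulo \<open>W\<close>. For
      \<open>w\<close> in \<open>W\<close>, a bounded lift \<open>z\<close> of
      \<open>S x - P w\<close> satisfies \<open>S (x - z) = P w\<close>, so \<open>x - z\<close> is
      in \<open>W\<close> and the distance from \<open>x\<close> to \<open>W\<close> is at most
      \<open>c * norm (S x - P w)\<close>, hence at most
      \<open>c * norm (R x) + q * dist x w\<close>. The infimum over \<open>w\<close> lets the last
      term be absorbed, as \<open>q < 1\<close>.\<close>
    have dist_le: "infdist x W \<le> c / (1 - q) * norm (R x)" if x: "x \<in> M" for x
    proof -
      have "(infdist x W - c * norm (R x)) / q \<le> dist x w" if w: "w \<in> W" for w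
      proof -
        let ?y = "S x - P w"
        obtain w' where w': "w' \<in> M" "S w' = P w"
          using inv[OF w P(2,3)] WS by force
        have "?y = S (x - w')"
          using w' by (simp add: linear_diff[OF bounded_linear.linear[OF S]])
        then have "?y \<in> S ` M" using x w' M(2) by (simp add: subspace_diff)
        then obtain z where z: "z \<in> M" "S z = ?y" "norm z \<le> c * norm ?y" using c by blast
        have "S (x - z) = P w"
          using z by (simp add: linear_diff[OF bounded_linear.linear[OF S]])
        then have "S (x - z) \<in> W" using inv[OF w P(2,3)] by simp
        then have "x - z \<in> W" by (rule pre[OF subspace_diff[OF M(2) x z(1)]])
        then have "infdist x W \<le> dist x (x - z)" by (rule infdist_le)
        also have "\<dots> \<le> c * norm ?y" using z by (simp add: dist_norm)
        also have "?y = R x + P (x - w)"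
          by (simp add: R_def linear_diff[OF bounded_linear.linear[OF P(1)]])
        also have "c * norm (R x + P (x - w)) \<le> c * (norm (R x) + r * norm (x - w))"
          using c Pr[of "x - w"] norm_triangle_ineq[of "R x" "P (x - w)"]
          by (intro mult_left_mono) auto
        finally have "infdist x W - c * norm (R x) \<le> q * dist x w"
          by (simp add: q_def dist_norm algebra_simps)
        then show ?thesis using q by (simp add: divide_le_eq mult.commute)
      qed
      then have "(infdist x W - c * norm (R x)) / q \<le> infdist x W"
        unfolding infdist_notempty[OF W0] by (intro cINF_greatest W0)
      then have "infdist x W * (1 - q) \<le> c * norm (R x)"
        using q by (simp add: divide_le_eq algebra_simps)
      then show ?thesis using q by (simp add: pos_le_divide_eq)
    qed
    \<comment> \<open>The distance to \<open>W\<close> need not be attained; the factor 2 leaves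
      room for a nearly closest point.\<close>
    define C where "C = 2 * (c / (1 - q))"
    have C: "C > 0" using c q by (simp add: C_def)
    have lift: "\<exists>u\<in>M. x - u \<in> W \<and> norm u \<le> C * norm (R x)" if x: "x \<in> M" for x
    proof (cases "infdist x W = 0")
      case True
      then have "x \<in> W" using in_closed_iff_infdist_zero[OF clW W0] by blast
      then show ?thesis using C M(2) by (intro bexI[of _ 0]) (auto simp: subspace_0)
    next
      case False
      then have pos: "infdist x W > 0" using infdist_nonneg[of x W] by linarith
      have "\<exists>w\<in>W. dist x w < 2 * infdist x W"
      proof (rule ccontr)
        assume "\<not> ?thesis"
        then have "2 * infdist x W \<le> infdist x W"
          by (subst (2) infdist_notempty[OF W0]) (intro cINF_greatest W0, force)
        then show False using pos by simp
      qed
      then obtain w where w: "w \<in> W" "dist x w < 2 * infdist x W" by blast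
      have "norm (x - w) \<le> C * norm (R x)"
        using w(2) dist_le[OF x] unfolding C_def dist_norm by linarith
      then show ?thesis using w x WM M(2)
        by (intro bexI[of _ "x - w"]) (auto simp: subspace_diff)
    qed
    obtain B where B: "B > 0" "\<And>x. norm (R x) \<le> norm x * B"
      using bounded_linear.pos_bounded[OF blR] by blast
    have "closed (R ` M)"
    proof (rule closed_image_if_bounded_lifting[OF blR M(1,2)])
      fix y assume "y \<in> R ` M"
      then obtain x where x: "x \<in> M" "y = R x" by blast
      \<comment> \<open>The lift of \<open>y\<close> is built in two stages: \<open>u\<close> lifts
        it modulo \<open>W\<close> with control, and the remainder
        \<open>y - R u = R (x - u)\<close>, which lies in \<open>W\<close>, is lifted inside
        \<open>W\<close> by \<open>onto\<close>.\<close>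
      obtain u where u: "u \<in> M" "x - u \<in> W" "norm u \<le> C * norm y"
        using lift[OF x(1)] x(2) by blast
      obtain w where w: "w \<in> W" "R w = R (x - u)" "norm w \<le> c / (1 - q) * norm (R (x - u))"
        using onto[OF RW[OF u(2)]] by blast
      have "norm (R (x - u)) \<le> norm y + norm (R u)"
        using x norm_triangle_ineq4 by (simp add: linear_diff[OF linR])
      also have "norm (R u) \<le> C * norm y * B"
        using B(2)[of u] mult_right_mono[OF u(3), of B] B(1) by linarith
      finally have "norm (R (x - u)) \<le> norm y + C * norm y * B" by simp
      then have "norm w \<le> c / (1 - q) * (norm y + C * norm y * B)"
        using w(3) c q by (meson divide_nonneg_pos less_imp_le diff_gt_0_iff_gt mult_left_mono order_trans)
      then have "norm (u + w) \<le> (C + c / (1 - q) * (1 + C * B)) * norm y"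
        using u(3) norm_triangle_ineq[of u w] by (simp add: algebra_simps add_divide_distrib)
      moreover have "R (u + w) = y" using w x by (simp add: linear_diff[OF linR] linear_add[OF linR])
      moreover have "u + w \<in> M" using u w WM M(2) by (auto intro: subspace_add)
      ultimately show "\<exists>x\<in>M. R x = y \<and> norm x \<le> (C + c / (1 - q) * (1 + C * B)) * norm y"
        by blast
    qed
    moreover have "{x\<in>M. R x = 0} \<subseteq> (R ^^ n) ` M" for n
    proof clarify
      fix x assume x: "x \<in> M" "R x = 0"
      then have "infdist x W = 0" using dist_le[of x] infdist_nonneg[of x W] by simp
      then have "x \<in> W" using in_closed_iff_infdist_zero[OF clW W0] by blast
      then show "x \<in> (R ^^ n) ` M" using Wpow by blast
    qed
    ultimately show "kato_on M (\<lambda>x. S x - P x)" by (simp add: kato_on_def flip: R_def)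
  qed
qed

section \<open>Finite-dimensional and complex subspaces\<close>

lemma mem_set_plus: "x \<in> S + T \<longleftrightarrow> (\<exists>a\<in>S. \<exists>b\<in>T. x = a + b)"
  by (auto simp: set_plus_def)

lemma subspace_set_plus:
  assumes "subspace S" "subspace T"
  shows "subspace (S + T)"
proof -
  have "S + T = {x + y |x y. x \<in> S \<and> y \<in> T}" by (auto simp: set_plus_def)
  then show ?thesis using subspace_sums[OF assms] by simp
qed

lemma image_span_subset:
  assumes "linear f" "f ` G \<subseteq> span H"
  shows "f ` span G \<subseteq> span H"
  using assms by (simp add: span_minimal flip: linear_span_image)

lemma span_Un_plus: "span (S \<union> T) = span S + span T"
  unfolding span_Un set_plus_def by blast

lemma subspace_fin_basis:
  assumes V: "subspace V" "V \<subseteq> span B0" and B0: "finite B0"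
  obtains B where "finite B" "independent B" "span B = V" "card B \<le> card B0"
proof -
  obtain B where B: "B \<subseteq> V" "independent B" "V \<subseteq> span B"
    using maximal_independent_subset by blast
  have "finite B \<and> card B \<le> card B0"
    using B V by (intro independent_span_bound B0) auto
  moreover have "span B = V" using B V span_minimal by blast
  ultimately show ?thesis using B that by blast
qed

text \<open>The strict drop in cardinality is what makes the induction in
  \<open>kato_decomposition\<close> terminate.\<close>

lemma subspace_fin_basis_less:
  assumes V: "subspace V" "V \<subseteq> span B0" and B0: "finite B0"
    and x: "x \<in> span B0" "x \<notin> V"
  obtains B where "finite B" "span B = V" "card B < card B0"
proof -
  obtain B where B: "finite B" "independent B" "span B = V"
    using subspace_fin_basis[OF V B0] by blast
  have "independent (insert x B)" using B x by (simp add: independent_insert)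
  moreover have "insert x B \<subseteq> span B0" using B V x span_superset[of B] by blast
  ultimately have "card (insert x B) \<le> card B0"
    using independent_span_bound[OF B0] by blast
  moreover have "x \<notin> B" using x B span_superset[of B] by blast
  ultimately show ?thesis using B that by simp
qed

text \<open>If \<open>b\<close> is outside \<open>L\<close>, its positive distance \<open>d\<close>
  from \<open>L\<close> controls the coefficient of \<open>b\<close> in
  \<open>l + t *\<^sub>R b\<close>, hence both components. The addition map \<open>F\<close> on the
  product of \<open>L\<close> with the real line therefore has bounded lifting.\<close>

lemma closed_plus_line:
  fixes L :: "'a::banach set"
  assumes L: "closed L" "subspace L"
  shows "closed (L + span {b})"
proof (cases "b \<in> L")
  case True
  then have "span {b} \<subseteq> L" using L(2) by (intro span_minimal) auto
  then have "L + span {b} \<subseteq> L"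
    using L(2) by (auto simp: mem_set_plus intro!: subspace_add)
  moreover have "L \<subseteq> L + span {b}"
    using set_plus_intro[OF _ span_zero, of _ L "{b}"] by auto
  ultimately have "L + span {b} = L" by blast
  then show ?thesis using L by simp
next
  case False
  have L0: "L \<noteq> {}" using L(2) subspace_0 by blast
  define d where "d = infdist b L"
  have d: "d > 0" unfolding d_def by (rule infdist_pos_not_in_closed[OF L(1) L0 False])
  define F where "F = (\<lambda>p::'a \<times> real. fst p + snd p *\<^sub>R b)"
  have F: "bounded_linear F" unfolding F_def
    by (intro bounded_linear_add bounded_linear_fst
        bounded_linear_compose[OF bounded_linear_scaleR_left bounded_linear_snd])
  have im: "F ` (L \<times> UNIV) = L + span {b}"
    by (fastforce simp: F_def span_singleton set_plus_def image_iff)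
  have "closed (F ` (L \<times> UNIV))"
  proof (rule closed_image_if_bounded_lifting[OF F])
    show "closed (L \<times> (UNIV::real set))" using L by (intro closed_Times) auto
    show "subspace (L \<times> (UNIV::real set))" using L by (intro subspace_Times) auto
    fix y assume "y \<in> F ` (L \<times> UNIV)"
    then obtain l t where l: "l \<in> L" "y = l + t *\<^sub>R b" unfolding F_def by fastforce
    have t: "\<bar>t\<bar> * d \<le> norm y"
    proof (cases "t = 0")
      case False
      \<comment> \<open>Dividing \<open>y\<close> by \<open>t\<close> gives the difference between
        \<open>b\<close> and a point of \<open>L\<close>.\<close>
      have "d \<le> dist b (- (inverse t *\<^sub>R l))"
        unfolding d_def using l L(2) by (intro infdist_le) (simp add: subspace_scale subspace_neg)
      also have "\<dots> = norm (inverse t *\<^sub>R y)"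
        using False l by (simp add: dist_norm algebra_simps)
      finally show ?thesis using False by (simp add: field_simps)
    qed simp
    then have t': "\<bar>t\<bar> \<le> norm y / d" using d by (simp add: pos_le_divide_eq)
    have "norm l \<le> norm y + \<bar>t\<bar> * norm b"
      using norm_triangle_ineq4[of y "t *\<^sub>R b"] l(2) by simp
    also have "\<bar>t\<bar> * norm b \<le> norm y / d * norm b" using t' by (intro mult_right_mono) auto
    finally have "norm (l, t) \<le> (1 + norm b / d + 1 / d) * norm y"
      using t' norm_Pair_le[of l t] by (simp add: algebra_simps)
    then show "\<exists>x\<in>L \<times> UNIV. F x = y \<and> norm x \<le> (1 + norm b / d + 1 / d) * norm y"
      using l by (intro bexI[of _ "(l, t)"]) (auto simp: F_def)
  qed
  then show ?thesis by (simp add: im)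
qed

lemma closed_plus_span:
  fixes L :: "'a::banach set"
  assumes "finite B" and L: "closed L" "subspace L"
  shows "closed (L + span B)"
  using assms(1)
proof (induction B rule: finite_induct)
  case empty
  then show ?case using L by simp
next
  case (insert b B)
  have "L + span (insert b B) = (L + span B) + span {b}"
    using span_Un_plus[of "{b}" B] by (simp add: add_ac)
  then show ?case
    using closed_plus_line[OF insert.IH, of b] L by (simp add: subspace_set_plus)
qed

lemma closed_fin_dim:
  fixes V :: "'a::banach set"
  assumes "subspace V" "fin_dim V"
  shows "closed V"
proof -
  obtain B where "finite B" "span B = V"
    using assms subspace_fin_basis unfolding fin_dim_def by metis
  then show ?thesis using closed_plus_span[of B "{0}"] by (simp add: subspace_0 subspace_def)
qed

lemma fin_dim_plus:
  assumes "fin_dim S" "fin_dim T"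
  shows "fin_dim (S + T)"
proof -
  obtain A B where "finite A" "finite B" "S \<subseteq> span A" "T \<subseteq> span B"
    using assms unfolding fin_dim_def by blast
  then have "S + T \<subseteq> span (A \<union> B)" "finite (A \<union> B)"
    by (simp_all add: span_Un_plus set_plus_mono2)
  then show ?thesis unfolding fin_dim_def by blast
qed

text \<open>Adding the kernel to \<open>L\<close> does not change the image, keeps \<open>L\<close>
  closed because the kernel is finite-dimensional, and makes \<open>closed_image_subspace\<close>
  applicable.\<close>

lemma closed_image_fin_kernel:
  fixes A :: "'a::banach \<Rightarrow> 'a"
  assumes A: "bounded_linear A" and N: "closed N" "subspace N" "closed (A ` N)"
    and ker: "fin_dim {x\<in>N. A x = 0}" and L: "closed L" "subspace L" "L \<subseteq> N"
  shows "closed (A ` L)"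
proof -
  note lin = bounded_linear.linear[OF A]
  let ?K = "{x\<in>N. A x = 0}"
  have subK: "subspace ?K"
    using N(2) by (auto simp: subspace_def linear_0[OF lin] linear_add[OF lin] linear_cmul[OF lin])
  obtain B where B: "finite B" "span B = ?K"
    using subspace_fin_basis[OF subK] ker unfolding fin_dim_def by metis
  have "closed (A ` (L + ?K))"
  proof (rule closed_image_subspace[OF A N])
    show "closed (L + ?K)" using closed_plus_span[OF B(1) L(1,2)] B(2) by simp
    show "subspace (L + ?K)" by (intro subspace_set_plus L subK)
    show "L + ?K \<subseteq> N" using L(3) N(2) by (auto simp: set_plus_def intro: subspace_add)
    show "?K \<subseteq> L + ?K" using subspace_0[OF L(2)] by (metis (lifting) add_0 set_plus_intro subsetI)
  qed
  moreover have "A ` (L + ?K) = A ` L"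
  proof
    show "A ` (L + ?K) \<subseteq> A ` L" by (auto simp: set_plus_def linear_add[OF lin])
    have "L \<subseteq> L + ?K" using subspace_0[OF subK] by (metis (lifting) add.right_neutral set_plus_intro subsetI)
    then show "A ` L \<subseteq> A ` (L + ?K)" by blast
  qed
  ultimately show ?thesis by simp
qed

section \<open>Complex subspaces, complex lines and closed complex hyperplanes\<close>

context
  fixes J :: "'a::banach \<Rightarrow> 'a"
  assumes J: "complex_structure J"
begin

lemma linear_J: "linear J" and J_J: "J (J x) = - x"
  using J by (auto simp: complex_structure_def intro: bounded_linear.linear)

lemma cscale_cscale: "cscale J a (cscale J b x) = cscale J (a * b) x"
  by (simp add: cscale_def linear_add[OF linear_J] linear_cmul[OF linear_J] J_J algebra_simps)

lemma cscale_1: "cscale J 1 x = x"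
  by (simp add: cscale_def)

lemma csubspace_cscale: "csubspace J M \<Longrightarrow> x \<in> M \<Longrightarrow> cscale J c x \<in> M"
  by (auto simp: csubspace_def cscale_def intro!: subspace_add subspace_scale)

lemma csubspace_cscale_iff:
  assumes "csubspace J M" "c \<noteq> 0"
  shows "cscale J c x \<in> M \<longleftrightarrow> x \<in> M"
proof
  assume "cscale J c x \<in> M"
  then have "cscale J (inverse c) (cscale J c x) \<in> M" by (rule csubspace_cscale[OF assms(1)])
  then show "x \<in> M" using assms(2) by (simp add: cscale_cscale cscale_1)
qed (rule csubspace_cscale[OF assms(1)])

lemma csubspace_set_plus:
  assumes "csubspace J M" "csubspace J N"
  shows "csubspace J (M + N)"
proof -
  have "J x \<in> M + N" if x: "x \<in> M + N" for x
  proof -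
    obtain a b where "a \<in> M" "b \<in> N" "x = a + b" using x by (auto simp: mem_set_plus)
    then show ?thesis
      using assms by (simp add: linear_add[OF linear_J] csubspace_def set_plus_intro)
  qed
  then show ?thesis using assms by (simp add: csubspace_def subspace_set_plus)
qed

text \<open>The complex line through \<open>x\<close> is written as a real span, so that facts on
  real spans apply, while its elements can still be taken as complex multiples of
  \<open>x\<close>.\<close>

lemma cline_eq: "span {x, J x} = range (\<lambda>c. cscale J c x)"
proof
  show "range (\<lambda>c. cscale J c x) \<subseteq> span {x, J x}"
    unfolding cscale_def by (intro image_subsetI span_add span_scale span_base) auto
  have "y \<in> range (\<lambda>c. cscale J c x)" if "y \<in> span {x, J x}" for y
  proof -
    obtain k where "y - k *\<^sub>R x \<in> span {J x}" using \<open>y \<in> _\<close> by (auto simp: span_breakdown_eq)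
    then obtain l where "y - k *\<^sub>R x = l *\<^sub>R J x" by (auto simp: span_singleton)
    then have "y = cscale J (Complex k l) x" by (simp add: cscale_def algebra_simps)
    then show ?thesis by blast
  qed
  then show "span {x, J x} \<subseteq> range (\<lambda>c. cscale J c x)" by blast
qed

lemma csubspace_span:
  assumes "J ` G \<subseteq> span G"
  shows "csubspace J (span G)"
  using image_span_subset[OF linear_J assms] by (auto simp: csubspace_def)

lemma csubspace_cline: "csubspace J (span {x, J x})"
  by (rule csubspace_span) (auto simp: J_J intro: span_base span_neg)

text \<open>\<open>L\<close> is enlarged by the complex lines through those elements of
  \<open>B\<close> that are not yet in \<open>H + span {x, J x}\<close>; finitely many lines
  preserve closedness. If \<open>L\<close> and \<open>B\<close> together span a space containing
  \<open>x\<close>, then \<open>H\<close> is a complement there to the complex line of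
  \<open>x\<close>.\<close>

lemma ex_closed_hyperplane:
  assumes "finite B" and L: "csubspace J L" "closed L" "x \<notin> L"
  obtains H where "csubspace J H" "closed H" "L \<subseteq> H" "x \<notin> H" "B \<subseteq> H + span {x, J x}"
proof -
  have "\<exists>H. csubspace J H \<and> closed H \<and> L \<subseteq> H \<and> x \<notin> H \<and> B \<subseteq> H + span {x, J x}"
    using assms(1)
  proof (induction B rule: finite_induct)
    case empty
    then show ?case using L by blast
  next
    case (insert b B)
    then obtain H where H: "csubspace J H" "closed H" "L \<subseteq> H" "x \<notin> H"
      "B \<subseteq> H + span {x, J x}" by blast
    show ?case
    proof (cases "b \<in> H + span {x, J x}")
      case True
      then show ?thesis using H by blast
    next
      case False
      let ?H = "H + span {b, J b}"
      have sub: "H \<subseteq> ?H" using set_plus_intro[OF _ span_zero, of _ H] by auto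
      have b: "b \<in> ?H"
        using set_plus_intro[of 0 H b "span {b, J b}"] H(1)
        by (simp add: csubspace_def subspace_0 span_base)
      have 1: "csubspace J ?H" by (intro csubspace_set_plus H csubspace_cline)
      have 2: "closed ?H"
        using H(1,2) by (intro closed_plus_span) (auto simp: csubspace_def)
      \<comment> \<open>If \<open>x = h + cscale J c b\<close>, then \<open>c\<close> is nonzero
        because \<open>x\<close> is not in \<open>H\<close>, and solving for \<open>b\<close> would
        put it into \<open>H + span {x, J x}\<close>.\<close>
      have 3: "x \<notin> ?H"
      proof
        assume "x \<in> ?H"
        then obtain h c where h: "h \<in> H" "x = h + cscale J c b"
          unfolding cline_eq by (auto simp: mem_set_plus)
        then have c: "c \<noteq> 0" using H(4) by (auto simp: cscale_def)
        have "x \<in> H + span {x, J x}"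
          using set_plus_intro[of 0 H x "span {x, J x}"] H(1)
          by (simp add: csubspace_def subspace_0 span_base)
        moreover have "h \<in> H + span {x, J x}"
          using set_plus_intro[OF h(1) span_zero, of "{x, J x}"] by simp
        moreover have cs: "csubspace J (H + span {x, J x})"
          by (intro csubspace_set_plus H csubspace_cline)
        ultimately have "x - h \<in> H + span {x, J x}"
          by (simp add: csubspace_def subspace_diff)
        then have "cscale J c b \<in> H + span {x, J x}" using h(2) by simp
        then show False using csubspace_cscale_iff[OF cs c] False by blast
      qed
      have "insert b B \<subseteq> ?H + span {x, J x}"
      proof -
        have "b \<in> ?H + span {x, J x}" using set_plus_intro[OF b span_zero, of "{x, J x}"] by simp
        moreover have "B \<subseteq> ?H + span {x, J x}"
          using H(5) set_plus_mono2[OF sub order_refl] by blast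
        ultimately show ?thesis by simp
      qed
      then show ?thesis using 1 2 3 sub H(3) by blast
    qed
  qed
  then show ?thesis using that by blast
qed

end

section \<open>The Kato decomposition of a Fredholm operator\<close>

context
  fixes J A :: "'a::banach \<Rightarrow> 'a"
  assumes J: "complex_structure J" and A: "cblinear_op J A"
begin

lemma bounded_linear_A: "bounded_linear A" and A_J: "A (J x) = J (A x)"
  using A by (auto simp: cblinear_op_def)

lemma linear_A: "linear A"
  by (rule bounded_linear.linear[OF bounded_linear_A])

lemma linear_pow: "linear (A ^^ n)"
  by (rule bounded_linear.linear[OF bounded_linear_funpow[OF bounded_linear_A]])

lemma pow_J: "(A ^^ n) (J x) = J ((A ^^ n) x)"
  by (rule funpow_commute[of A J, OF A_J])

lemma pow_cscale: "(A ^^ n) (cscale J c x) = cscale J c ((A ^^ n) x)"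
  by (simp add: cscale_def linear_add[OF linear_pow] linear_cmul[OF linear_pow] pow_J)

lemma csubspace_pow_image: "csubspace J N \<Longrightarrow> csubspace J ((A ^^ n) ` N)"
  by (auto simp: csubspace_def linear_subspace_image[OF linear_pow] simp flip: pow_J)

text \<open>The conditions defining \<open>M\<close>, tested on the chain, form a triangular system:
  \<open>(A ^^ i) ((A ^^ j) z)\<close> is 0 for \<open>i + j > m\<close> and outside
  \<open>H\<close> for \<open>i + j = m\<close>. Triangularity yields both the trivial intersection
  and the decomposition of \<open>N\<close>.\<close>

lemma split_off_chain:
  assumes N: "csubspace J N" "closed N" "A ` N \<subseteq> N"
    and H: "csubspace J H" "closed H" "(A ^^ Suc m) ` N \<subseteq> H"
    and z: "z \<in> N" "(A ^^ m) z \<notin> H" "(A ^^ Suc m) z = 0"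
    and NH: "N \<subseteq> H + span {(A ^^ m) z, J ((A ^^ m) z)}"
  obtains M G where "csubspace J M" "closed M" "A ` M \<subseteq> M" "M \<subseteq> N"
    "finite G" "csubspace J (span G)" "A ` span G \<subseteq> span G" "span G \<subseteq> N"
    "(A ^^ m) z \<in> span G" "\<And>x. x \<in> span G \<Longrightarrow> (A ^^ Suc m) x = 0"
    "M \<inter> span G = {0}" "N \<subseteq> M + span G"
proof -
  define M where "M = N \<inter> (\<Inter>i\<in>{..m}. (A ^^ i) -` H)"
  define G where "G = (\<Union>j\<in>{..m}. {(A ^^ j) z, J ((A ^^ j) z)})"
  let ?K = "span G"
  have subH: "subspace H" and subN: "subspace N" using H N by (auto simp: csubspace_def)
  have high: "(A ^^ j) z = 0" if "j > m" for j
  proof -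
    have "(A ^^ ((j - Suc m) + Suc m)) z = 0"
      using z(3) linear_0[OF linear_pow] by (simp only: funpow_add comp_apply)
    then show ?thesis using that by simp
  qed
  have GK: "(A ^^ j) z \<in> ?K" for j
  proof (cases "j \<le> m")
    case True
    then show ?thesis unfolding G_def by (intro span_base) auto
  qed (simp add: high span_zero)
  have JGK: "J ((A ^^ j) z) \<in> ?K" for j
  proof (cases "j \<le> m")
    case True
    then show ?thesis unfolding G_def by (intro span_base) auto
  qed (simp add: high span_zero linear_0[OF linear_J[OF J]])
  have G_cases: "\<exists>j. g = (A ^^ j) z \<or> g = J ((A ^^ j) z)" if "g \<in> G" for g
    using that unfolding G_def by blast
  have JG: "J ` G \<subseteq> ?K"
    using G_cases GK JGK by (fastforce simp: J_J[OF J] span_neg)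
  have csK: "csubspace J ?K" by (rule csubspace_span[OF J JG])
  have AG: "A ` G \<subseteq> ?K"
  proof -
    have "A ((A ^^ j) z) \<in> ?K" "J (A ((A ^^ j) z)) \<in> ?K" for j
      using GK[of "Suc j"] JGK[of "Suc j"] by simp_all
    then show ?thesis using G_cases by (fastforce simp: A_J)
  qed
  have GN: "G \<subseteq> N"
    using z(1) N funpow_image_subset[OF N(3)] by (auto simp: G_def csubspace_def image_subset_iff)
  have nil: "(A ^^ Suc m) x = 0" if x: "x \<in> ?K" for x
  proof -
    have "G \<subseteq> {x. (A ^^ Suc m) x = 0}"
    proof -
      have "(A ^^ Suc m) ((A ^^ j) z) = 0" for j
        using high[of "Suc m + j"] by (simp only: funpow_add comp_apply)
      then show ?thesis
        by (auto simp: G_def pow_J linear_0[OF linear_J[OF J]] simp del: funpow.simps)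
    qed
    moreover have "subspace {x. (A ^^ Suc m) x = 0}" by (rule linear_subspace_kernel[OF linear_pow])
    ultimately show ?thesis using span_minimal[of G] x by blast
  qed
  have csM: "csubspace J M"
  proof -
    have "subspace M"
      unfolding M_def
      by (intro subspace_inter subN subspace_Inter) (auto intro: linear_subspace_vimage linear_pow subH)
    then show ?thesis using N(1) H(1) by (auto simp: M_def csubspace_def pow_J)
  qed
  have clM: "closed M"
    unfolding M_def
    by (intro closed_Int N closed_INT ballI closed_vimage H linear_continuous_on
        bounded_linear_funpow bounded_linear_A)
  have AM: "A ` M \<subseteq> M"
  proof clarify
    fix x assume x: "x \<in> M"
    have "(A ^^ i) (A x) \<in> H" if i: "i \<le> m" for i
    proof -
      have eq: "(A ^^ i) (A x) = (A ^^ Suc i) x" by (simp add: funpow_swap1)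
      show ?thesis
      proof (cases "i = m")
        case True
        then show ?thesis unfolding eq using x H(3) by (auto simp: M_def simp del: funpow.simps)
      next
        case False
        then have "Suc i \<le> m" using i by simp
        then show ?thesis unfolding eq using x unfolding M_def by blast
      qed
    qed
    then show "A x \<in> M" using x N(3) by (auto simp: M_def)
  qed
  have split: "\<exists>c. \<exists>y\<in>?K. x = cscale J c z + A y" if x: "x \<in> ?K" for x
  proof -
    have sub: "subspace (span {z, J z} + A ` ?K)"
      by (intro subspace_set_plus linear_subspace_image linear_A subspace_span)
    have cs: "csubspace J (span {z, J z} + A ` ?K)"
      using csubspace_pow_image[OF csK, of 1]
      by (intro csubspace_set_plus[OF J] csubspace_cline[OF J]) simp
    have "(A ^^ j) z \<in> span {z, J z} + A ` ?K" for j
    proof (cases j)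
      case 0
      have "z + 0 \<in> span {z, J z} + A ` ?K"
        using linear_0[OF linear_A] span_zero[of G] by (intro set_plus_intro span_base) (auto simp: image_iff intro!: bexI[of _ 0])
      then show ?thesis using 0 by simp
    next
      case (Suc i)
      have "0 + A ((A ^^ i) z) \<in> span {z, J z} + A ` ?K"
        by (intro set_plus_intro span_zero imageI GK)
      then show ?thesis using Suc by simp
    qed
    then have "G \<subseteq> span {z, J z} + A ` ?K" using cs by (auto simp: G_def csubspace_def)
    then have "x \<in> span {z, J z} + A ` ?K" using span_minimal[OF _ sub] x by blast
    then show ?thesis unfolding cline_eq[OF J] by (auto simp: mem_set_plus)
  qed
  have "x = 0" if xM: "x \<in> M" and xK: "x \<in> ?K" for x
  proof -
    \<comment> \<open>An element of the intersection is pushed into ever higher powers: applying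
      \<open>A ^^ (m - k)\<close> isolates the \<open>z\<close>-coefficient \<open>c\<close> of
      \<open>y\<close> in front of \<open>(A ^^ m) z\<close>, and membership in \<open>H\<close>
      forces \<open>c = 0\<close>. After \<open>Suc m\<close> rounds nilpotency gives 0.\<close>
    have "\<exists>y\<in>?K. x = (A ^^ k) y" if "k \<le> Suc m" for k
      using that
    proof (induction k)
      case 0
      then show ?case using xK by simp
    next
      case (Suc k)
      then obtain y where y: "y \<in> ?K" "x = (A ^^ k) y" by auto
      obtain c y' where y': "y' \<in> ?K" "y = cscale J c z + A y'" using split[OF y(1)] by blast
      have "(A ^^ (m - k)) x = (A ^^ m) y"
        using Suc.prems y(2) by (simp flip: comp_apply[of "A ^^ _" "A ^^ _"] funpow_add)
      also have "\<dots> = cscale J c ((A ^^ m) z) + (A ^^ Suc m) y'"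
        unfolding y'(2) by (simp add: linear_add[OF linear_pow] pow_cscale funpow_swap1)
      finally have "(A ^^ (m - k)) x = cscale J c ((A ^^ m) z)" using nil[OF y'(1)] by simp
      moreover have "(A ^^ (m - k)) x \<in> H" using xM by (auto simp: M_def)
      ultimately have "c = 0" using csubspace_cscale_iff[OF J H(1)] z(2) by metis
      then have "x = (A ^^ Suc k) y'" using y y' by (simp add: cscale_def funpow_swap1)
      then show ?case using y' by blast
    qed
    from this[of "Suc m"] show ?thesis using nil by force
  qed
  then have int: "M \<inter> ?K = {0}"
    using csM by (auto simp: csubspace_def subspace_0 span_zero)
  have "x \<in> M + ?K" if x: "x \<in> N" for x
  proof -
    \<comment> \<open>The conditions are enforced from \<open>i = m\<close> downwards: adding a multiple of \<open>A\<^sup>k z\<close> changes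
      \<open>A\<^sup>i x\<close> only for \<open>i \<le> m - k\<close>.\<close>
    have "\<exists>u\<in>?K. \<forall>i. Suc m \<le> i + k \<longrightarrow> (A ^^ i) (x - u) \<in> H" if "k \<le> Suc m" for k
      using that
    proof (induction k)
      case 0
      have "(A ^^ i) x \<in> H" if i: "Suc m \<le> i" for i
      proof -
        obtain j where "i = Suc m + j" using i le_Suc_ex by blast
        then have "(A ^^ i) x = (A ^^ Suc m) ((A ^^ j) x)" by (simp only: funpow_add comp_apply)
        moreover have "(A ^^ j) x \<in> N" using funpow_image_subset[OF N(3)] x by blast
        ultimately show ?thesis using H(3) by auto
      qed
      then show ?case by (intro bexI[of _ 0] span_zero) auto
    next
      case (Suc k)
      then obtain u where u: "u \<in> ?K" "\<And>i. Suc m \<le> i + k \<Longrightarrow> (A ^^ i) (x - u) \<in> H" by auto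
      have "span G \<subseteq> N" using GN subN by (rule span_minimal)
      then have "x - u \<in> N" using u(1) x subN by (auto intro: subspace_diff)
      then have "(A ^^ (m - k)) (x - u) \<in> N" using funpow_image_subset[OF N(3)] by blast
      then obtain h c where h: "h \<in> H" "(A ^^ (m - k)) (x - u) = h + cscale J c ((A ^^ m) z)"
        using NH unfolding cline_eq[OF J] by (fastforce simp: mem_set_plus)
      define u' where "u' = u + cscale J c ((A ^^ k) z)"
      have "u' \<in> ?K" unfolding u'_def
        using csubspace_cscale[OF J csK GK] u(1) by (intro span_add) auto
      moreover have "(A ^^ i) (x - u') \<in> H" if i: "Suc m \<le> i + Suc k" for i
      proof -
        have eq: "(A ^^ i) (x - u') = (A ^^ i) (x - u) - cscale J c ((A ^^ (i + k)) z)"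
          unfolding u'_def
          by (simp add: linear_diff[OF linear_pow] linear_add[OF linear_pow] pow_cscale funpow_add)
        show ?thesis
        proof (cases "i + k = m")
          case True
          then have "i = m - k" by simp
          then show ?thesis using eq h True by simp
        next
          case False
          then have "i + k > m" using i by simp
          then show ?thesis using eq u(2)[of i] high by (simp add: cscale_def linear_0[OF linear_J[OF J]])
        qed
      qed
      ultimately show ?case by blast
    qed
    from this[of "Suc m"] obtain u where u: "u \<in> ?K" "\<And>i. (A ^^ i) (x - u) \<in> H" by auto
    have "span G \<subseteq> N" using GN subN by (rule span_minimal)
    then have "x - u \<in> M" using u x subN by (auto simp: M_def intro: subspace_diff)
    then have "(x - u) + u \<in> M + ?K" using u(1) by (rule set_plus_intro)
    then show ?thesis by simp
  qed
  then have dec: "N \<subseteq> M + ?K" by blast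
  show ?thesis
  proof (rule that[OF csM clM AM _ _ csK _ _ GK nil int dec])
    show "M \<subseteq> N" by (auto simp: M_def)
    show "finite G" by (simp add: G_def)
    show "A ` ?K \<subseteq> ?K" by (rule image_span_subset[OF linear_A AG])
    show "?K \<subseteq> N" using GN subN by (rule span_minimal)
  qed
qed

text \<open>Induction on the size of a spanning set \<open>B0\<close> of the kernel; this is why
  finite sets appear instead of \<open>fin_dim\<close>. \<open>B1\<close> witnesses finite
  codimension of the range, which is needed to find the hyperplane and must pass to the smaller
  space.\<close>

lemma kato_decomposition:
  assumes "csubspace J N" "closed N" "A ` N \<subseteq> N" "closed (A ` N)"
    and "finite B0" "{x\<in>N. A x = 0} \<subseteq> span B0"
    and "finite B1" "N \<subseteq> A ` N + span B1"
  shows "\<exists>N1 N2 n. csubspace J N1 \<and> csubspace J N2 \<and> closed N1 \<and> N1 \<subseteq> N \<and> N2 \<subseteq> N \<and>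
    A ` N1 \<subseteq> N1 \<and> A ` N2 \<subseteq> N2 \<and> N1 \<inter> N2 = {0} \<and> N \<subseteq> N1 + N2 \<and> fin_dim N2 \<and>
    kato_on N1 A \<and> (\<forall>x\<in>N2. (A ^^ n) x = 0)"
  using assms
proof (induction "card B0" arbitrary: N B0 B1 rule: less_induct)
  case less
  note N = less.prems(1-3) and clA = less.prems(4) and B0 = less.prems(5,6) and B1 = less.prems(7,8)
  let ?ker = "{x\<in>N. A x = 0}"
  have subN: "subspace N" using N by (simp add: csubspace_def)
  have fdk: "fin_dim ?ker" using B0 by (auto simp: fin_dim_def)
  have clim: "closed (A ` L)" if "closed L" "subspace L" "L \<subseteq> N" for L
    by (rule closed_image_fin_kernel[OF bounded_linear_A N(2) subN clA fdk that])
  show ?case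
  proof (cases "\<forall>n. ?ker \<subseteq> (A ^^ n) ` N")
    case True
    then have "kato_on N A" using clA by (simp add: kato_on_def)
    moreover have "csubspace J {0}" by (simp add: csubspace_def linear_0[OF linear_J[OF J]])
    moreover have "fin_dim {0 :: 'a}" unfolding fin_dim_def by (intro exI[of _ "{}"]) simp
    moreover have "N \<inter> {0} = {0}" "{0} \<subseteq> N" using subspace_0[OF subN] by auto
    moreover have "A ` {0} \<subseteq> {0}" by (simp add: linear_0[OF linear_A])
    moreover have "N \<subseteq> N + {0}" by (simp flip: set_zero)
    ultimately show ?thesis using N
      by (intro exI[of _ N] exI[of _ "{0}"] exI[of _ 0] conjI) auto
  next
    case False
    \<comment> \<open>Minimality puts the kernel inside \<open>(A ^^ m)\<close> N\<open>for\<close>n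
      = Suc m\<open>, so a kernel vector\<close>x1\<open>outside\<close>(A ^^ n) \<open>N\<close>
      has the form \<open>(A ^^ m) z\<close>. The case \<open>n = 0\<close> cannot occur.\<close>
    define n where "n = (LEAST n. \<not> ?ker \<subseteq> (A ^^ n) ` N)"
    have n: "\<not> ?ker \<subseteq> (A ^^ n) ` N" "\<And>k. k < n \<Longrightarrow> ?ker \<subseteq> (A ^^ k) ` N"
      unfolding n_def using False LeastI_ex[of "\<lambda>n. \<not> ?ker \<subseteq> (A ^^ n) ` N"] not_less_Least by auto
    have "n \<noteq> 0"
    proof
      assume "n = 0"
      then show False using n(1) by auto
    qed
    then obtain m where m: "n = Suc m" using not0_implies_Suc by blast
    obtain x1 where x1: "x1 \<in> N" "A x1 = 0" "x1 \<notin> (A ^^ Suc m) ` N" using n(1) m by blast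
    then obtain z where z: "z \<in> N" "x1 = (A ^^ m) z" using n(2)[of m] m by blast
    have clpow: "closed ((A ^^ k) ` N)" for k
    proof (induction k)
      case 0
      then show ?case using N by simp
    next
      case (Suc k)
      have "closed (A ` ((A ^^ k) ` N))"
        using Suc by (intro clim linear_subspace_image linear_pow subN funpow_image_subset N)
      then show ?case by (simp add: image_comp)
    qed
    have codim: "\<exists>B. finite B \<and> N \<subseteq> (A ^^ k) ` N + span B" for k
    proof (induction k)
      case 0
      have "N \<subseteq> (A ^^ 0) ` N + span {}" by (simp flip: set_zero)
      then show ?case by blast
    next
      case (Suc k)
      then obtain B where B: "finite B" "N \<subseteq> (A ^^ k) ` N + span B" by blast
      have "N \<subseteq> (A ^^ Suc k) ` N + span (A ` B \<union> B1)"
      proof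
        fix x assume "x \<in> N"
        then obtain y b1 where y: "y \<in> N" "b1 \<in> span B1" "x = A y + b1"
          using B1(2) by (fastforce simp: mem_set_plus)
        obtain w b where w: "w \<in> N" "b \<in> span B" "y = (A ^^ k) w + b"
          using y(1) B(2) by (fastforce simp: mem_set_plus)
        have "x = (A ^^ Suc k) w + (A b + b1)" using y w by (simp add: linear_add[OF linear_A])
        moreover have "A b \<in> span (A ` B)" using w(2) by (simp add: linear_span_image[OF linear_A])
        then have "(A ^^ Suc k) w + (A b + b1) \<in> (A ^^ Suc k) ` N + span (A ` B \<union> B1)"
          unfolding span_Un_plus by (intro set_plus_intro imageI w(1) y(2))
        ultimately show "x \<in> (A ^^ Suc k) ` N + span (A ` B \<union> B1)" by (simp only:)
      qed
      then show ?case using B(1) B1(1) by (intro exI[of _ "A ` B \<union> B1"] conjI finite_UnI finite_imageI)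
    qed
    obtain B where B: "finite B" "N \<subseteq> (A ^^ Suc m) ` N + span B" using codim by blast
    obtain H where H: "csubspace J H" "closed H" "(A ^^ Suc m) ` N \<subseteq> H" "x1 \<notin> H"
      "B \<subseteq> H + span {x1, J x1}"
      by (rule ex_closed_hyperplane[OF J B(1) csubspace_pow_image[OF N(1)] clpow x1(3)])
    have NH: "N \<subseteq> H + span {x1, J x1}"
    proof -
      have sub: "subspace (H + span {x1, J x1})"
        using H(1) by (intro subspace_set_plus) (auto simp: csubspace_def)
      have "span B \<subseteq> H + span {x1, J x1}" by (rule span_minimal[OF H(5) sub])
      moreover have "(A ^^ Suc m) ` N \<subseteq> H + span {x1, J x1}"
      proof
        fix x assume "x \<in> (A ^^ Suc m) ` N"
        then have "x + 0 \<in> H + span {x1, J x1}" using H(3) by (intro set_plus_intro span_zero) blast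
        then show "x \<in> H + span {x1, J x1}" by simp
      qed
      ultimately have "(A ^^ Suc m) ` N + span B \<subseteq> H + span {x1, J x1}"
        using subspace_add[OF sub] by (intro subsetI) (elim set_plus_elim, simp only: subset_iff)
      then show ?thesis using B(2) by (rule order_trans[rotated])
    qed
    have z0: "(A ^^ Suc m) z = 0" using z x1 by simp
    obtain M G where M: "csubspace J M" "closed M" "A ` M \<subseteq> M" "M \<subseteq> N"
      and G: "finite G" "csubspace J (span G)" "A ` span G \<subseteq> span G" "span G \<subseteq> N"
        "(A ^^ m) z \<in> span G" "\<And>x. x \<in> span G \<Longrightarrow> (A ^^ Suc m) x = 0"
      and MG: "M \<inter> span G = {0}" "N \<subseteq> M + span G"
      by (rule split_off_chain[OF N H(1-3) z(1) H(4)[unfolded z(2)] z0 NH[unfolded z(2)]]) (rule that)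
    let ?K = "span G"
    have subM: "subspace M" using M by (simp add: csubspace_def)
    have subkM: "subspace {x\<in>M. A x = 0}"
      using subM by (auto simp: subspace_def linear_0[OF linear_A] linear_add[OF linear_A] linear_cmul[OF linear_A])
    have "x1 \<noteq> 0" using H(1,4) by (auto simp: csubspace_def subspace_0)
    \<comment> \<open>\<open>x1\<close> is a nonzero kernel vector in the chain space, so it is
      missing from \<open>M\<close>, and the kernel on \<open>M\<close> is strictly smaller.\<close>
    then have "x1 \<notin> {x\<in>M. A x = 0}" using G(5) z MG(1) by blast
    then obtain B2 where B2: "finite B2" "span B2 = {x\<in>M. A x = 0}" "card B2 < card B0"
      using subspace_fin_basis_less[OF subkM _ B0(1), of x1] B0(2) M(4) x1 by blast
    have clAM: "closed (A ` M)" by (rule clim[OF M(2) subM M(4)])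
    \<comment> \<open>Preimages are taken in \<open>N\<close> and split along
      \<open>M + span G\<close>; the chain part maps into \<open>span G\<close> by
      invariance.\<close>
    have MA: "M \<subseteq> A ` M + span (G \<union> B1)"
    proof
      fix x assume "x \<in> M"
      then obtain y b where y: "y \<in> N" "b \<in> span B1" "x = A y + b"
        using B1(2) M(4) by (fastforce simp: mem_set_plus)
      obtain u k where u: "u \<in> M" "k \<in> ?K" "y = u + k"
        using y(1) MG(2) by (fastforce simp: mem_set_plus)
      have "x = A u + (A k + b)" using y u by (simp add: linear_add[OF linear_A])
      moreover have "A k \<in> ?K" using u(2) G(3) by blast
      then have "A u + (A k + b) \<in> A ` M + span (G \<union> B1)"
        unfolding span_Un_plus by (intro set_plus_intro imageI u(1) y(2))
      ultimately show "x \<in> A ` M + span (G \<union> B1)" by (simp only:)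
    qed
    obtain N1 N2 p where IH: "csubspace J N1" "csubspace J N2" "closed N1" "N1 \<subseteq> M" "N2 \<subseteq> M"
      "A ` N1 \<subseteq> N1" "A ` N2 \<subseteq> N2" "N1 \<inter> N2 = {0}" "M \<subseteq> N1 + N2" "fin_dim N2"
      "kato_on N1 A" "\<forall>x\<in>N2. (A ^^ p) x = 0"
      using less.hyps[OF B2(3) M(1-3) clAM B2(1) eq_refl[OF B2(2)[symmetric]] finite_UnI[OF G(1) B1(1)] MA]
      by (elim exE conjE) (rule that)
    have "csubspace J (N2 + ?K)" by (intro csubspace_set_plus[OF J] IH G)
    moreover have "N1 \<subseteq> N" using IH(4) M(4) by blast
    moreover have "N2 + ?K \<subseteq> N"
      using subspace_add[OF subN] subsetD[OF order_trans[OF IH(5) M(4)]] subsetD[OF G(4)]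
      by (intro subsetI) (elim set_plus_elim, simp only:)
    moreover have "A ` (N2 + ?K) \<subseteq> N2 + ?K"
    proof clarify
      fix x assume "x \<in> N2 + ?K"
      then obtain a k where "a \<in> N2" "k \<in> ?K" "x = a + k" by (auto simp: mem_set_plus)
      then show "A x \<in> N2 + ?K"
        using IH(7) G(3) by (auto simp: linear_add[OF linear_A] intro!: set_plus_intro)
    qed
    moreover have "N1 \<inter> (N2 + ?K) = {0}"
    proof -
      have "x = 0" if x: "x \<in> N1" "x \<in> N2 + ?K" for x
      proof -
        obtain a k where a: "a \<in> N2" "k \<in> ?K" "x = a + k" using x(2) by (auto simp: mem_set_plus)
        have "x - a \<in> M" using x a IH(4,5) by (intro subspace_diff[OF subM]) auto
        then have "k = 0" using a MG(1) by auto
        then show "x = 0" using a x IH(8) by auto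
      qed
      moreover have "0 \<in> N1" "0 \<in> N2 + ?K"
        using IH(1) csubspace_set_plus[OF J IH(2) G(2)] by (auto simp: csubspace_def subspace_0)
      ultimately show ?thesis by blast
    qed
    moreover have "N \<subseteq> N1 + (N2 + ?K)"
      using order_trans[OF MG(2) set_plus_mono2[OF IH(9) order_refl]] by (simp only: add.assoc)
    moreover have "fin_dim (N2 + ?K)"
      using G(1) by (intro fin_dim_plus IH) (auto simp: fin_dim_def)
    \<comment> \<open>The sum of the two nilpotency exponents annihilates both summands.\<close>
    moreover have "\<forall>x\<in>N2 + ?K. (A ^^ (p + Suc m)) x = 0"
    proof
      fix x assume "x \<in> N2 + ?K"
      then obtain a k where a: "a \<in> N2" "k \<in> ?K" "x = a + k" by (auto simp: mem_set_plus)
      have "(A ^^ (p + Suc m)) k = (A ^^ p) ((A ^^ Suc m) k)" by (simp only: funpow_add comp_apply)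
      then have "(A ^^ (p + Suc m)) k = 0" using G(6)[OF a(2)] linear_0[OF linear_pow] by simp
      moreover have "(A ^^ (Suc m + p)) a = (A ^^ Suc m) ((A ^^ p) a)" by (simp only: funpow_add comp_apply)
      then have "(A ^^ (p + Suc m)) a = 0"
        using bspec[OF IH(12) a(1)] linear_0[OF linear_pow, of "Suc m"] by (simp only: add.commute)
      ultimately show "(A ^^ (p + Suc m)) x = 0" using a by (simp add: linear_add[OF linear_pow] del: funpow.simps)
    qed
    ultimately show ?thesis using IH(1,3,6,11) by blast
  qed
qed

end

section \<open>Direct sums\<close>

lemma direct_sum_eq_plus: "direct_sum M N \<longleftrightarrow> M \<inter> N = {0} \<and> M + N = UNIV"
  by (auto simp: direct_sum_def mem_set_plus set_eq_iff)

text \<open>Addition maps the product of \<open>M\<close> and \<open>N\<close> bijectively onto the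
  whole space, so \<open>closed_image_subspace\<close> applies to the product of \<open>P\<close>
  and \<open>Q\<close> with trivial kernel.\<close>

lemma closed_plus_direct_sum:
  fixes M :: "'a::banach set"
  assumes M: "closed M" "subspace M" and N: "closed N" "subspace N" and MN: "direct_sum M N"
    and P: "closed P" "subspace P" "P \<subseteq> M" and Q: "closed Q" "subspace Q" "Q \<subseteq> N"
  shows "closed (P + Q)"
proof -
  let ?F = "\<lambda>p::'a \<times> 'a. fst p + snd p"
  have F: "bounded_linear ?F" by (intro bounded_linear_add bounded_linear_fst bounded_linear_snd)
  have im: "?F ` (S \<times> R) = S + R" for S R by (auto simp: mem_set_plus image_iff)
  have "closed (?F ` (P \<times> Q))"
  proof (rule closed_image_subspace[OF F, of "M \<times> N"])
    show "closed (?F ` (M \<times> N))" using MN by (simp add: im direct_sum_eq_plus)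
    show "{x \<in> M \<times> N. fst x + snd x = 0} \<subseteq> P \<times> Q"
    proof clarsimp
      fix a b assume ab: "a \<in> M" "b \<in> N" "a + b = 0"
      then have "a = - b" by (simp add: eq_neg_iff_add_eq_0)
      then have "a \<in> M \<inter> N" using ab N by (auto simp: subspace_neg)
      then have "a = 0" using MN by (auto simp: direct_sum_def)
      then have "a = 0" "b = 0" using ab(3) by auto
      then show "a \<in> P \<and> b \<in> Q" using P Q by (simp add: subspace_0)
    qed
  qed (use assms in \<open>auto intro: closed_Times subspace_Times\<close>)
  then show ?thesis by (simp add: im)
qed

text \<open>Directness makes everything componentwise: if \<open>A (a + b) = 0\<close>, then
  \<open>A a = - A b\<close> lies in both \<open>M\<close> and \<open>N\<close>, so \<open>a\<close>
  and \<open>b\<close> are kernel vectors separately.\<close>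

lemma kato_on_plus:
  fixes A :: "'a::banach \<Rightarrow> 'a"
  assumes A: "bounded_linear A"
    and M: "closed M" "subspace M" "A ` M \<subseteq> M" "kato_on M A"
    and N: "closed N" "subspace N" "A ` N \<subseteq> N" and MN: "direct_sum M N"
    and Q: "subspace Q" "Q \<subseteq> N" "A ` Q \<subseteq> Q" "kato_on Q A"
  shows "kato_on (M + Q) A"
proof -
  have linp: "linear (A ^^ n)" for n
    by (rule bounded_linear.linear[OF bounded_linear_funpow[OF A]])
  note lin = bounded_linear.linear[OF A]
  have im: "(A ^^ n) ` (M + Q) = (A ^^ n) ` M + (A ^^ n) ` Q" for n
  proof (intro equalityI subsetI)
    fix x assume "x \<in> (A ^^ n) ` (M + Q)"
    then obtain a b where "a \<in> M" "b \<in> Q" "x = (A ^^ n) (a + b)" by (auto simp: mem_set_plus)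
    then show "x \<in> (A ^^ n) ` M + (A ^^ n) ` Q"
      by (auto simp: linear_add[OF linp] intro!: set_plus_intro)
  next
    fix x assume "x \<in> (A ^^ n) ` M + (A ^^ n) ` Q"
    then obtain a b where "a \<in> M" "b \<in> Q" "x = (A ^^ n) (a + b)"
      by (auto simp: mem_set_plus linear_add[OF linp])
    then show "x \<in> (A ^^ n) ` (M + Q)" by blast
  qed
  have "closed (A ` M + A ` Q)"
    using M Q by (intro closed_plus_direct_sum[OF M(1,2) N(1,2) MN])
      (auto simp: kato_on_def intro: linear_subspace_image[OF lin])
  moreover have "{x \<in> M + Q. A x = 0} \<subseteq> (A ^^ n) ` (M + Q)" for n
  proof clarify
    fix x assume x: "x \<in> M + Q" "A x = 0"
    then obtain a b where ab: "a \<in> M" "b \<in> Q" "x = a + b" by (auto simp: mem_set_plus)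
    then have eq: "A a = - A b" using x(2) by (simp add: linear_add[OF lin] eq_neg_iff_add_eq_0)
    have "A b \<in> N" using ab Q by blast
    then have "A a \<in> M \<inter> N" using ab M(3) N(2) eq by (auto simp: subspace_neg)
    then have "A a = 0" using MN unfolding direct_sum_def by blast
    then have "A a = 0" "A b = 0" using eq by auto
    then show "x \<in> (A ^^ n) ` (M + Q)"
      unfolding im ab(3) using ab M(4) Q(4) by (intro set_plus_intro) (auto simp: kato_on_def)
  qed
  ultimately show ?thesis using im[of 1] by (simp add: kato_on_def)
qed

section \<open>Assembly of the decomposition of the whole space\<close>

theorem theorem3p5:
  fixes J T :: "'a::banach \<Rightarrow> 'a"
  assumes "complex_structure J"
    and "\<not> fin_dim (UNIV :: 'a set)"
    and "cblinear_op J T"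
    and "\<exists>M N. GKRD J T M N"
  shows "\<exists>\<epsilon>>0. \<forall>l::complex. 0 < cmod l \<and> cmod l < \<epsilon> \<longrightarrow>
           essentially_kato J (\<lambda>x. T x - cscale J l x)"
proof -
  note J = assms(1) and T = assms(3)
  obtain M N where "GKRD J T M N" using assms(4) by blast
  then have M: "csubspace J M" "closed M" "T ` M \<subseteq> M" "kato_on M T"
    and N: "csubspace J N" "closed N" "T ` N \<subseteq> N" "riesz_on J N T" and MN: "direct_sum M N"
    by (auto simp: GKRD_def)
  have sub: "subspace M" "subspace N" using M N by (auto simp: csubspace_def)
  have blT: "bounded_linear T" using T by (simp add: cblinear_op_def)
  obtain e where e: "e > 0"
    "\<And>P r. bounded_linear P \<Longrightarrow> (\<And>x. T (P x) = P (T x)) \<Longrightarrow> P ` M \<subseteq> M \<Longrightarrow>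
      0 < r \<Longrightarrow> r < e \<Longrightarrow> (\<And>x. norm (P x) \<le> r * norm x) \<Longrightarrow> kato_on M (\<lambda>x. T x - P x)"
    using kato_on_perturbation[OF blT M(2) sub(1) M(3,4)] by blast
  have "essentially_kato J (\<lambda>x. T x - cscale J l x)" if l: "0 < cmod l" "cmod l < e" for l
  proof -
    define A where "A = (\<lambda>x. T x - cscale J l x)"
    have bll: "bounded_linear (cscale J l)"
      unfolding cscale_def using J
      by (intro bounded_linear_add bounded_linear_const_scaleR bounded_linear_ident)
        (simp add: complex_structure_def)
    have Tl: "T (cscale J l x) = cscale J l (T x)" for x
      using pow_cscale[OF J T, of 1] by simp
    have blA: "bounded_linear A" unfolding A_def by (intro bounded_linear_sub blT bll)
    have cA: "cblinear_op J A"
    proof -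
      have "cscale J l (J x) = J (cscale J l x)" for x
        by (simp add: cscale_def linear_add[OF linear_J[OF J]] linear_cmul[OF linear_J[OF J]])
      then show ?thesis using T blA
        by (simp add: cblinear_op_def A_def linear_diff[OF linear_J[OF J]])
    qed
    have AM: "A ` M \<subseteq> M"
      using M csubspace_cscale[OF J M(1)] by (auto simp: A_def intro!: subspace_diff sub)
    have AN: "A ` N \<subseteq> N"
      using N csubspace_cscale[OF J N(1)] by (auto simp: A_def intro!: subspace_diff sub)
    have kM: "kato_on M A"
      unfolding A_def
    proof (rule e(2)[OF bll Tl _ l])
      show "cscale J l ` M \<subseteq> M" using csubspace_cscale[OF J M(1)] by blast
      show "norm (cscale J l x) \<le> cmod l * norm x" for x
        using J by (simp add: complex_structure_def)
    qed
    \<comment> \<open>Here the puncture at 0 enters: the Riesz property speaks only about nonzero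
      \<open>l\<close>.\<close>
    have "fredholm_on N A" using N(4) l by (auto simp: riesz_on_def A_def)
    then obtain F B0 where F: "fin_dim F" "N \<subseteq> {a + f | a f. a \<in> A ` N \<and> f \<in> F}"
      "closed (A ` N)" and B0: "finite B0" "{x\<in>N. A x = 0} \<subseteq> span B0"
      by (auto simp: fredholm_on_def fin_dim_def[of "{x\<in>N. A x = 0}"])
    obtain B1 where B1: "finite B1" "F \<subseteq> span B1" using F(1) by (auto simp: fin_dim_def)
    have "N \<subseteq> A ` N + span B1"
    proof
      fix x assume "x \<in> N"
      then have "x \<in> {a + f | a f. a \<in> A ` N \<and> f \<in> F}" by (rule subsetD[OF F(2)])
      then obtain a f where af: "a \<in> A ` N" "f \<in> F" "x = a + f" by blast
      show "x \<in> A ` N + span B1"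
        unfolding af(3) by (intro set_plus_intro af(1) subsetD[OF B1(2) af(2)])
    qed
    from kato_decomposition[OF J cA N(1,2) AN F(3) B0 B1(1) this]
    obtain N1 N2 n where D: "csubspace J N1" "csubspace J N2" "closed N1" "N1 \<subseteq> N" "N2 \<subseteq> N"
      "A ` N1 \<subseteq> N1" "A ` N2 \<subseteq> N2" "N1 \<inter> N2 = {0}" "N \<subseteq> N1 + N2" "fin_dim N2"
      "kato_on N1 A" "\<forall>x\<in>N2. (A ^^ n) x = 0"
      by (elim exE conjE) (rule that)
    have subD: "subspace N1" "subspace N2" using D by (auto simp: csubspace_def)
    \<comment> \<open>The Kato part \<open>N1\<close> of the Fredholm piece is joined to
      \<open>M\<close>; only the nilpotent part \<open>N2\<close> remains as the finite-dimensional
      summand.\<close>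
    have "direct_sum (M + N1) N2"
      unfolding direct_sum_eq_plus
    proof
      have "x = 0" if x: "x \<in> M + N1" "x \<in> N2" for x
      proof -
        obtain a b where a: "a \<in> M" "b \<in> N1" "x = a + b" using x(1) by (auto simp: mem_set_plus)
        have "x - b \<in> N" using x a D(4,5) by (intro subspace_diff sub) auto
        then have "a = 0" using a MN by (auto simp: direct_sum_def)
        then show "x = 0" using a x D(8) by auto
      qed
      moreover have "0 \<in> M + N1" "0 \<in> N2"
        using subspace_0[OF subspace_set_plus[OF sub(1) subD(1)]] subspace_0[OF subD(2)] by auto
      ultimately show "(M + N1) \<inter> N2 = {0}" by blast
      have "M + N \<subseteq> M + (N1 + N2)" by (intro set_plus_mono2 D order_refl)
      then show "M + N1 + N2 = UNIV" using MN by (simp add: direct_sum_eq_plus add.assoc top_unique)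
    qed
    moreover have "closed (M + N1)"
      by (rule closed_plus_direct_sum[OF M(2) sub(1) N(2) sub(2) MN])
        (use M sub D subD in auto)
    moreover have "kato_on (M + N1) A"
      by (rule kato_on_plus[OF blA M(2) sub(1) AM kM N(2) sub(2) AN MN subD(1) D(4,6,11)])
    moreover have "A ` (M + N1) \<subseteq> M + N1"
    proof clarify
      fix x assume "x \<in> M + N1"
      then obtain a b where "a \<in> M" "b \<in> N1" "x = a + b" by (auto simp: mem_set_plus)
      then show "A x \<in> M + N1"
        using AM D(6) by (auto simp: linear_add[OF bounded_linear.linear[OF blA]] intro!: set_plus_intro)
    qed
    moreover have "csubspace J (M + N1)" by (intro csubspace_set_plus[OF J] M D)
    moreover have "closed N2" by (rule closed_fin_dim[OF subD(2) D(10)])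
    ultimately have "essentially_kato J A"
      using D(2,7,10,12) unfolding essentially_kato_def by blast
    then show ?thesis by (simp add: A_def)
  qed
  then show ?thesis using e(1) by blast
qed

end
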